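(* Let $d$ be a divisor of $\mu$, and let $\Sigma$ be a $(G,k,\mu)$ strong difference family of type $d$ with respect to the prime power $q\equiv1\pmod{\mu}$, associated with a collection $\mathfrak{C}$ of subsets of $G\times\mathbb{F}_q$ such that: 1) the projection of $\mathfrak{C}$ on $G$ coincides with $\Sigma$; 2) $\Delta\mathfrak{C}=\bigcup_{g\in G}(\{g\}\times D_g)$, where $D_g=C_0^{(q-1)/d,q}\cdot L_g$ and $L_g$ is a multiset of size $\mu/d$ on $\mathbb{F}_q^*$. If for each $g\in G$, $L_g$ is a system of representatives for $C_0^{\mu/d,q}$ in $\mathbb{F}_q^*$, then, given a system of representatives $S$ for $C_0^{(q-1)/d,q}$ in $C_0^{\mu/d,q}$, the family $\mathfrak{B}=[C\cdot\{(1,s)\}: s\in S,\ C\in\mathfrak{C}]$ is a $(G\times\mathbb{F}_q,G\times\{0\},k,1)$-DF.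
   Context: Square brackets denote multisets; all unions of multisets preserve multiplicities; $\underline{h}A$ denotes the union of $h$ copies of $A$. If $A,B$ are multisets on a multiplicative group, $A\cdot B:=[ab:a\in A,b\in B]$ (a multiset). For a multiset (or set) $F$ with elements $f_1,\dots,f_k$ in a group written additively, $\Delta F:=[f_a-f_b:1\le a,b\le k,\ a\ne b]$, and for a family, $\Delta$ is the multiset union of $\Delta$ over its members. A $(G,k,\mu)$ strong difference family (SDF) is a family $\Sigma$ of multisets of size $k$ of a finite group $(G,+)$ such that $\Delta\Sigma=\underline{\mu}G$, i.e. every element of $G$ (0 included) appears exactly $\mu$ times in $\Delta\Sigma$. $\mathbb{F}_q$ is the finite field of order $q$, $\mathbb{F}_q^*$ its multiplicative group; if $q\equiv1\pmod e$, $C_0^{e,q}$ denotes the group of nonzero $e$th powers of $\mathbb{F}_q$. A system of representatives for a subgroup $H$ in a group $K$ contains exactly one element of each coset of $H$ in $K$. In $G\times\mathbb{F}_q$ the additive group of $\mathbb{F}_q$ is used for differences. For a divisor $d$ of $\mu$ and a prime power $q\equiv1\pmod d$, a $(G,k,\mu)$-SDF $\Sigma$ is of type $d$ with respect to $q$ if there is a collection $\mathfrak{C}$ of subsets of $G\times\mathbb{F}_q$ satisfying conditions 1) and 2) of the claim (the projection of each member of $\mathfrak{C}$ on $G$ being taken as a multiset). For $(x,y)\in G\times\mathbb{F}_q$ and $s\in\mathbb{F}_q^*$, $(x,y)\cdot(1,s):=(x,ys)$, and $C\cdot\{(1,s)\}:=\{c\cdot(1,s):c\in C\}$. A $(G,N,k,\lambda)$-DF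 (relative difference family), for a finite group $(G,+)$ and a subgroup $N$, is a family $[B_1,\dots,B_r]$ of $k$-subsets of $G$ such that $\bigcup_{i=1}^r\Delta B_i=\underline{\lambda}(G\setminus N)$, i.e. every element of $G\setminus N$ appears exactly $\lambda$ times and no element of $N$ appears. *)

theory Defs
  imports
    "HOL-Algebra.Multiplicative_Group"
    "HOL-Number_Theory.Cong"
    "HOL-Library.Multiset"
begin

text \<open>
  Groups are those of HOL-Algebra and are not assumed to be abelian. HOL-Algebra writes groups
  multiplicatively, so the difference \<open>x - y\<close> appears below as
  \<open>x \<otimes>\<^bsub>G\<^esub> inv\<^bsub>G\<^esub> y\<close>. Families of sets or of multisets are themselves multisets, so that
  repeated members are allowed.
\<close>

text \<open>
  Occurrences, rather than values, are required to be distinct: an element of multiplicity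
  \<open>m\<close> contributes \<open>m * (m - 1)\<close> times the neutral element.
\<close>
definition differences :: "('a, 'm) monoid_scheme \<Rightarrow> 'a multiset \<Rightarrow> 'a multiset" where
  "differences G A =
     \<Sum>\<^sub># (image_mset (\<lambda>x. image_mset (\<lambda>y. x \<otimes>\<^bsub>G\<^esub> inv\<^bsub>G\<^esub> y) (A - {#x#})) A)"

definition family_differences :: "('a, 'm) monoid_scheme \<Rightarrow> 'a multiset multiset \<Rightarrow> 'a multiset" where
  "family_differences G \<A> = \<Sum>\<^sub># (image_mset (differences G) \<A>)"

definition mset_prod :: "('a, 'm) monoid_scheme \<Rightarrow> 'a multiset \<Rightarrow> 'a multiset \<Rightarrow> 'a multiset" where
  "mset_prod G A B = \<Sum>\<^sub># (image_mset (\<lambda>a. image_mset (\<lambda>b. a \<otimes>\<^bsub>G\<^esub> b) B) A)"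

definition strong_difference_family ::
  "('a, 'm) monoid_scheme \<Rightarrow> nat \<Rightarrow> nat \<Rightarrow> 'a multiset multiset \<Rightarrow> bool" where
  "strong_difference_family G k \<mu> \<Sigma> \<longleftrightarrow>
     group G \<and> finite (carrier G) \<and>
     (\<forall>A \<in># \<Sigma>. set_mset A \<subseteq> carrier G \<and> size A = k) \<and>
     family_differences G \<Sigma> = repeat_mset \<mu> (mset_set (carrier G))"

definition relative_difference_family ::
  "('a, 'm) monoid_scheme \<Rightarrow> 'a set \<Rightarrow> nat \<Rightarrow> nat \<Rightarrow> 'a set multiset \<Rightarrow> bool" where
  "relative_difference_family G N k l \<B> \<longleftrightarrow>
     group G \<and> finite (carrier G) \<and> subgroup N G \<and>
     (\<forall>B \<in># \<B>. B \<subseteq> carrier G \<and> card B = k) \<and>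
     family_differences G (image_mset mset_set \<B>) = repeat_mset l (mset_set (carrier G - N))"

definition finite_field_of_order :: "('b, 'n) ring_scheme \<Rightarrow> nat \<Rightarrow> bool" where
  "finite_field_of_order F q \<longleftrightarrow> field F \<and> finite (carrier F) \<and> order F = q"

definition nonzero_powers :: "('b, 'n) ring_scheme \<Rightarrow> nat \<Rightarrow> 'b set" where
  "nonzero_powers F e = {x [^]\<^bsub>F\<^esub> e | x. x \<in> carrier (mult_of F)}"

text \<open>
  A system of representatives is taken as a multiset, so multiplicities count: a repeated
  element is not allowed.
\<close>
definition system_of_representatives :: "('a, 'm) monoid_scheme \<Rightarrow> 'a set \<Rightarrow> 'a multiset \<Rightarrow> bool" where
  "system_of_representatives K H T \<longleftrightarrow>
     set_mset T \<subseteq> carrier K \<and>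
     (\<forall>c \<in> rcosets\<^bsub>K\<^esub> H. size (filter_mset (\<lambda>x. x \<in> c) T) = 1)"

abbreviation additive_product ::
  "('a, 'm) monoid_scheme \<Rightarrow> ('b, 'n) ring_scheme \<Rightarrow> ('a \<times> 'b) monoid" where
  "additive_product G F \<equiv> G \<times>\<times> add_monoid F"

text \<open>
  The collection \<open>\<CC>\<close> is made of sets, but its members are projected on \<open>G\<close> as multisets, and the
  image of a set of size \<open>k\<close> has \<open>k\<close> elements with multiplicity. Only the values \<open>L g\<close> with \<open>g\<close> in
  \<open>G\<close> matter. The set \<open>nonzero_powers F ((q - 1) div d)\<close> is the group of order \<open>d\<close> in the
  multiplicative group of \<open>F\<close>.
\<close>
definition type_witness ::
  "('a, 'm) monoid_scheme \<Rightarrow> ('b, 'n) ring_scheme \<Rightarrow> nat \<Rightarrow> nat \<Rightarrow> nat \<Rightarrow> 'a multiset multiset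
     \<Rightarrow> ('a \<times> 'b) set multiset \<Rightarrow> ('a \<Rightarrow> 'b multiset) \<Rightarrow> bool" where
  "type_witness G F q \<mu> d \<Sigma> \<CC> L \<longleftrightarrow>
     (\<forall>C \<in># \<CC>. C \<subseteq> carrier (additive_product G F)) \<and>
     image_mset (\<lambda>C. image_mset fst (mset_set C)) \<CC> = \<Sigma> \<and>
     (\<forall>g \<in> carrier G. set_mset (L g) \<subseteq> carrier (mult_of F) \<and> size (L g) = \<mu> div d) \<and>
     family_differences (additive_product G F) (image_mset mset_set \<CC>) =
       (\<Sum>g \<in> carrier G. image_mset (Pair g)
          (mset_prod (mult_of F) (mset_set (nonzero_powers F ((q - 1) div d))) (L g)))"

definition sdf_of_type ::
  "('a, 'm) monoid_scheme \<Rightarrow> nat \<Rightarrow> nat \<Rightarrow> nat \<Rightarrow> ('b, 'n) ring_scheme \<Rightarrow> nat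
     \<Rightarrow> 'a multiset multiset \<Rightarrow> bool" where
  "sdf_of_type G k \<mu> d F q \<Sigma> \<longleftrightarrow>
     strong_difference_family G k \<mu> \<Sigma> \<and> d dvd \<mu> \<and>
     finite_field_of_order F q \<and> [q = 1] (mod d) \<and>
     (\<exists>\<CC> L. type_witness G F q \<mu> d \<Sigma> \<CC> L)"

definition scale :: "('b, 'n) ring_scheme \<Rightarrow> 'b \<Rightarrow> ('a \<times> 'b) set \<Rightarrow> ('a \<times> 'b) set" where
  "scale F s C = (\<lambda>(x, y). (x, y \<otimes>\<^bsub>F\<^esub> s)) ` C"

definition scaled_family ::
  "('b, 'n) ring_scheme \<Rightarrow> 'b set \<Rightarrow> ('a \<times> 'b) set multiset \<Rightarrow> ('a \<times> 'b) set multiset" where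
  "scaled_family F S \<CC> = (\<Sum>s \<in> S. image_mset (scale F s) \<CC>)"

end

theory Submission
  imports Defs
begin

text \<open>
  Multiplication of the second coordinate by \<open>s \<noteq> 0\<close> is an injective endomorphism of
  \<open>G \<times> \<F>\<^sub>q\<close>, so it commutes with taking differences. Write \<open>H\<close> and \<open>K\<close> for the groups of nonzero
  \<open>(q - 1) / d\<close>-th and \<open>\<mu> / d\<close>-th powers. Since \<open>\<mu>\<close> divides \<open>q - 1\<close>, \<open>H\<close> is a subgroup of \<open>K\<close>,
  and over each \<open>g\<close> the differences of the scaled family form the multiset
  \<open>(H \<cdot> L\<^sub>g) \<cdot> S = (H \<cdot> S) \<cdot> L\<^sub>g = K \<cdot> L\<^sub>g = \<F>\<^sub>q\<^sup>*\<close>.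
\<close>

section \<open>Products and differences of multisets\<close>

lemma image_mset_sum_mset: "image_mset f (\<Sum>\<^sub># M) = (\<Sum>A\<in>#M. image_mset f A)"
  by (induction M) auto

lemma image_mset_sum: "image_mset f (\<Sum>a\<in>A. M a) = (\<Sum>a\<in>A. image_mset f (M a))"
  by (induction A rule: infinite_finite_induct) auto

text \<open>Grouping by the second factor exhibits the product as a union of right translates of
  \<open>A\<close>; when \<open>A\<close> is a subgroup these are its right cosets.\<close>

lemma mset_prod_swap:
  "mset_prod G A B = (\<Sum>b\<in>#B. image_mset (\<lambda>a. a \<otimes>\<^bsub>G\<^esub> b) A)"
  unfolding mset_prod_def
  \<comment> \<open>Once each inner image is written as a sum of singletons, both sides are double
    sums that differ only in the order of summation.\<close>
  by (subst (1 2) sum_mset_singleton_mset[symmetric]) (rule sum_mset.swap)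

lemma (in comm_monoid) mset_prod_right_commute:
  assumes "set_mset A \<subseteq> carrier G" "set_mset B \<subseteq> carrier G" "set_mset C \<subseteq> carrier G"
  shows "mset_prod G (mset_prod G A B) C = mset_prod G (mset_prod G A C) B"
proof -
  have "mset_prod G (mset_prod G A B) C
      = (\<Sum>c\<in>#C. \<Sum>b\<in>#B. image_mset (\<lambda>a. a \<otimes> b \<otimes> c) A)"
    by (simp add: mset_prod_swap image_mset_sum_mset multiset.map_comp comp_def)
  also have "\<dots> = (\<Sum>b\<in>#B. \<Sum>c\<in>#C. image_mset (\<lambda>a. a \<otimes> b \<otimes> c) A)"
    by (rule sum_mset.swap)
  also have "\<dots> = (\<Sum>b\<in>#B. \<Sum>c\<in>#C. image_mset (\<lambda>a. a \<otimes> c \<otimes> b) A)"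
    using assms
    by (intro arg_cong[where f = sum_mset] image_mset_cong) (auto simp: m_ac subset_iff)
  also have "\<dots> = mset_prod G (mset_prod G A C) B"
    by (simp add: mset_prod_swap image_mset_sum_mset multiset.map_comp comp_def)
  finally show ?thesis .
qed

text \<open>Right translation is injective, so each \<open>t\<close> in \<open>T\<close> contributes
  the coset \<open>H #> t\<close> with multiplicity one. The multiplicity of \<open>x\<close> is
  therefore the number of \<open>t\<close> in \<open>T\<close> whose coset contains
  \<open>x\<close>, which is one by the choice of \<open>T\<close>.\<close>

lemma (in group) mset_prod_system_of_representatives:
  assumes fin: "finite (carrier G)" and H: "subgroup H G"
    and T: "system_of_representatives G H T"
  shows "mset_prod G (mset_set H) T = mset_set (carrier G)"
proof (rule multiset_eqI)
  fix x
  have TG: "set_mset T \<subseteq> carrier G"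
    using T by (simp add: system_of_representatives_def)
  have HG: "H \<subseteq> carrier G"
    using H by (rule subgroup.subset)
  have coset: "image_mset (\<lambda>h. h \<otimes> t) (mset_set H) = mset_set (H #> t)" if "t \<in># T" for t
  proof -
    have "inj_on (\<lambda>h. h \<otimes> t) H"
      using that TG HG by (intro inj_onI) (meson right_cancel subsetD)
    moreover have "(\<lambda>h. h \<otimes> t) ` H = H #> t"
      by (auto simp: r_coset_def)
    ultimately show ?thesis
      by (simp add: image_mset_mset_set)
  qed
  have "finite (H #> t)" for t
    using finite_subset[OF HG fin] by (simp add: r_coset_def)
  then have "count (\<Sum>t\<in>#T. mset_set (H #> t)) x = size (filter_mset (\<lambda>t. x \<in> H #> t) T)"
    by (induction T) (auto simp: count_mset_set')
  moreover have "mset_prod G (mset_set H) T = (\<Sum>t\<in>#T. mset_set (H #> t))"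
    unfolding mset_prod_swap by (intro arg_cong[where f = sum_mset] image_mset_cong coset)
  ultimately have count: "count (mset_prod G (mset_set H) T) x
      = size (filter_mset (\<lambda>t. x \<in> H #> t) T)"
    by simp
  show "count (mset_prod G (mset_set H) T) x = count (mset_set (carrier G)) x"
  proof (cases "x \<in> carrier G")
    case True
    \<comment> \<open>The hypothesis on \<open>T\<close> counts the representatives in one fixed
      coset, so membership is turned around to make \<open>H #> x\<close> that coset.\<close>
    have "x \<in> H #> t \<longleftrightarrow> t \<in> H #> x" if "t \<in># T" for t
      using that TG True H by (metis repr_independence rcos_self subsetD)
    then have "filter_mset (\<lambda>t. x \<in> H #> t) T = filter_mset (\<lambda>t. t \<in> H #> x) T"
      by (intro filter_mset_cong) auto
    moreover have "H #> x \<in> rcosets H"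
      using True HG by (intro rcosetsI)
    ultimately show ?thesis
      using T True fin count by (simp add: system_of_representatives_def)
  next
    case False
    have "x \<notin> H #> t" if "t \<in># T" for t
      using False that TG HG r_coset_subset_G by blast
    then have "filter_mset (\<lambda>t. x \<in> H #> t) T = {#}"
      by (auto simp: multiset_eq_iff simp flip: not_in_iff)
    with False count show ?thesis by simp
  qed
qed

text \<open>A homomorphism carries the difference of \<open>x\<close> and \<open>y\<close> to that
  of their images. Pairs of occurrences are matched, so this also holds when \<open>f\<close>
  identifies elements of \<open>A\<close>.\<close>

lemma differences_hom_image:
  assumes "group G" "group H" "f \<in> hom G H" "set_mset A \<subseteq> carrier G"
  shows "differences H (image_mset f A) = image_mset f (differences G A)"
proof -
  interpret group_hom G H f
    using assms by (simp add: group_hom_def group_hom_axioms_def)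
  have summand: "image_mset (\<lambda>y. f x \<otimes>\<^bsub>H\<^esub> inv\<^bsub>H\<^esub> y) (image_mset f A - {#f x#})
      = image_mset f (image_mset (\<lambda>y. x \<otimes>\<^bsub>G\<^esub> inv\<^bsub>G\<^esub> y) (A - {#x#}))" if x: "x \<in># A" for x
  proof -
    \<comment> \<open>Since \<open>x\<close> occurs in \<open>A\<close>, removing one occurrence of
      it before or after applying \<open>f\<close> has the same effect.\<close>
    have "image_mset f A - {#f x#} = image_mset f (A - {#x#})"
      using x by (simp add: image_mset_Diff)
    then show ?thesis
      using x assms(4)
      by (auto simp: multiset.map_comp comp_def subset_iff dest!: in_diffD intro!: image_mset_cong)
  qed
  have "differences H (image_mset f A)
      = (\<Sum>x\<in>#A. image_mset (\<lambda>y. f x \<otimes>\<^bsub>H\<^esub> inv\<^bsub>H\<^esub> y) (image_mset f A - {#f x#}))"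
    by (simp add: differences_def multiset.map_comp comp_def)
  also have "\<dots> = (\<Sum>x\<in>#A. image_mset f (image_mset (\<lambda>y. x \<otimes>\<^bsub>G\<^esub> inv\<^bsub>G\<^esub> y) (A - {#x#})))"
    using summand by (intro arg_cong[where f = sum_mset] image_mset_cong)
  also have "\<dots> = image_mset f (differences G A)"
    by (simp add: differences_def image_mset_sum_mset multiset.map_comp comp_def)
  finally show ?thesis .
qed

section \<open>Groups of nonzero powers in a field\<close>

lemma (in comm_group) subgroup_powers:
  "subgroup {x [^] (n::nat) | x. x \<in> carrier G} G"
proof (rule subgroupI)
  show "{x [^] n | x. x \<in> carrier G} \<noteq> {}"
    by auto
  show "inv a \<in> {x [^] n | x. x \<in> carrier G}" if "a \<in> {x [^] n | x. x \<in> carrier G}" for a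
    using that by (auto simp flip: nat_pow_inv)
  show "a \<otimes> b \<in> {x [^] n | x. x \<in> carrier G}"
    if "a \<in> {x [^] n | x. x \<in> carrier G}" "b \<in> {x [^] n | x. x \<in> carrier G}" for a b
    using that by (auto simp flip: nat_pow_distrib)
qed auto

lemma (in field) comm_group_mult_of: "comm_group (mult_of R)"
  by (rule units_comm_group[folded mult_of_is_Units])

lemma (in field) subgroup_nonzero_powers: "subgroup (nonzero_powers R e) (mult_of R)"
  using comm_group.subgroup_powers[OF comm_group_mult_of, of e]
  by (simp add: nonzero_powers_def nat_pow_mult_of)

text \<open>If \<open>b = c * a\<close>, a \<open>b\<close>-th power of \<open>x\<close> is the
  \<open>a\<close>-th power of \<open>x [^] c\<close>. This will place the group \<open>H\<close>
  inside \<open>K\<close>.\<close>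

lemma (in field) nonzero_powers_mono:
  assumes "a dvd b"
  shows "nonzero_powers R b \<subseteq> nonzero_powers R a"
proof
  fix y assume "y \<in> nonzero_powers R b"
  then obtain x where x: "x \<in> carrier (mult_of R)" "y = x [^] b"
    by (auto simp: nonzero_powers_def)
  obtain c where c: "b = c * a"
    using assms by (metis dvd_def mult.commute)
  have "x [^] c \<in> carrier (mult_of R)"
    using x(1) group.is_monoid[OF field_mult_group] monoid.nat_pow_closed nat_pow_mult_of
    by metis
  moreover have "y = (x [^] c) [^] a"
    using x c by (simp add: nat_pow_pow)
  ultimately show "y \<in> nonzero_powers R a"
    by (auto simp: nonzero_powers_def)
qed

section \<open>Scaling the second coordinate\<close>

lemma scale_hom:
  assumes "group G" "field F" "s \<in> carrier F"
  shows "(\<lambda>(x, y). (x, y \<otimes>\<^bsub>F\<^esub> s)) \<in> hom (additive_product G F) (additive_product G F)"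
proof -
  interpret field F by fact
  show ?thesis
    using assms by (auto simp: hom_def l_distr)
qed

lemma scale_inj_on:
  assumes "field F" "s \<in> carrier (mult_of F)"
  shows "inj_on (\<lambda>(x, y). (x, y \<otimes>\<^bsub>F\<^esub> s)) (carrier (additive_product G F))"
proof -
  interpret field F by fact
  show ?thesis
    using assms(2) by (auto simp: inj_on_def m_rcancel)
qed

text \<open>Injectivity of the scaling makes the scaled set, viewed as a multiset, the image of the
  multiset of \<open>C\<close>; the homomorphism property then carries the scaling through the
  differences.\<close>

lemma family_differences_scale:
  assumes G: "group G" and F: "field F" and s: "s \<in> carrier (mult_of F)"
    and fin: "finite (carrier (additive_product G F))"
    and sub: "\<And>C. C \<in># \<CC> \<Longrightarrow> C \<subseteq> carrier (additive_product G F)"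
  shows "family_differences (additive_product G F) (image_mset mset_set (image_mset (scale F s) \<CC>))
    = image_mset (\<lambda>(x, y). (x, y \<otimes>\<^bsub>F\<^esub> s))
        (family_differences (additive_product G F) (image_mset mset_set \<CC>))"
proof -
  interpret F: field F by fact
  let ?P = "additive_product G F" and ?f = "\<lambda>(x, y). (x, y \<otimes>\<^bsub>F\<^esub> s)"
  have P: "group ?P"
    using G F.a_group by (rule DirProd_group)
  have "differences ?P (mset_set (scale F s C)) = image_mset ?f (differences ?P (mset_set C))"
    if C: "C \<in># \<CC>" for C
  proof -
    have "mset_set (scale F s C) = image_mset ?f (mset_set C)"
      using inj_on_subset[OF scale_inj_on[OF F s] sub[OF C]]
      by (simp add: scale_def image_mset_mset_set)
    moreover have "?f \<in> hom ?P ?P"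
      using s by (intro scale_hom[OF G F]) simp
    moreover have "set_mset (mset_set C) \<subseteq> carrier ?P"
      using sub[OF C] finite_subset[OF _ fin] by simp
    ultimately show ?thesis
      using differences_hom_image[OF P P] by metis
  qed
  then have "(\<Sum>C\<in>#\<CC>. differences ?P (mset_set (scale F s C)))
      = (\<Sum>C\<in>#\<CC>. image_mset ?f (differences ?P (mset_set C)))"
    by (intro arg_cong[where f = sum_mset] image_mset_cong)
  then show ?thesis
    by (simp add: family_differences_def image_mset_sum_mset multiset.map_comp comp_def)
qed

lemma family_differences_sum:
  "family_differences G (\<Sum>s\<in>S. M s) = (\<Sum>s\<in>S. family_differences G (M s))"
  by (induction S rule: infinite_finite_induct) (auto simp: family_differences_def)

text \<open>The slices over distinct first coordinates are disjoint, so the multiset of their union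
  is the sum of their multisets.\<close>

lemma mset_set_Times:
  assumes "finite A" "finite B"
  shows "mset_set (A \<times> B) = (\<Sum>a\<in>A. image_mset (Pair a) (mset_set B))"
proof -
  have "(\<Sum>a\<in>A. image_mset (Pair a) (mset_set B)) = (\<Sum>a\<in>A. mset_set (Pair a ` B))"
    by (simp add: image_mset_mset_set inj_on_def)
  also have "\<dots> = mset_set (\<Union>a\<in>A. Pair a ` B)"
    using assms
    by (induction A rule: finite_induct) (auto intro!: mset_set_Union[symmetric])
  also have "(\<Union>a\<in>A. Pair a ` B) = A \<times> B"
    by auto
  finally show ?thesis ..
qed

theorem proposition1:
  fixes G :: "('a, 'm) monoid_scheme"
    and F :: "('b, 'n) ring_scheme"
    and k \<mu> d q :: nat
    and \<Sigma> :: "'a multiset multiset"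
    and \<CC> :: "('a \<times> 'b) set multiset"
    and L :: "'a \<Rightarrow> 'b multiset"
    and S :: "'b set"
  assumes "d dvd \<mu>"
    and "finite_field_of_order F q"
    and "[q = 1] (mod \<mu>)"
    and "sdf_of_type G k \<mu> d F q \<Sigma>"
    and "type_witness G F q \<mu> d \<Sigma> \<CC> L"
    and "\<And>g. g \<in> carrier G \<Longrightarrow>
           system_of_representatives (mult_of F) (nonzero_powers F (\<mu> div d)) (L g)"
    and "system_of_representatives ((mult_of F)\<lparr>carrier := nonzero_powers F (\<mu> div d)\<rparr>)
           (nonzero_powers F ((q - 1) div d)) (mset_set S)"
  shows "relative_difference_family (additive_product G F) (carrier G \<times> {\<zero>\<^bsub>F\<^esub>}) k 1
           (scaled_family F S \<CC>)"
proof -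
  have F: "field F" and finF: "finite (carrier F)"
    using assms(2) by (auto simp: finite_field_of_order_def)
  interpret F: field F by fact
  interpret M: comm_group "mult_of F" by (rule F.comm_group_mult_of)
  have sdf: "strong_difference_family G k \<mu> \<Sigma>"
    using assms(4) by (simp add: sdf_of_type_def)
  then have G: "group G" and finG: "finite (carrier G)" and size: "\<And>A. A \<in># \<Sigma> \<Longrightarrow> size A = k"
    by (auto simp: strong_difference_family_def)
  let ?P = "additive_product G F"
  let ?H = "nonzero_powers F ((q - 1) div d)" and ?K = "nonzero_powers F (\<mu> div d)"
  have finP: "finite (carrier ?P)"
    using finG finF by simp
  have finM: "finite (carrier (mult_of F))"
    using finF by simp
  have sub: "\<And>C. C \<in># \<CC> \<Longrightarrow> C \<subseteq> carrier ?P"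
    and proj: "image_mset (\<lambda>C. image_mset fst (mset_set C)) \<CC> = \<Sigma>"
    and diff: "family_differences ?P (image_mset mset_set \<CC>) =
       (\<Sum>g \<in> carrier G. image_mset (Pair g) (mset_prod (mult_of F) (mset_set ?H) (L g)))"
    and L: "\<And>g. g \<in> carrier G \<Longrightarrow> set_mset (L g) \<subseteq> carrier (mult_of F)"
    using assms(5) by (auto simp: type_witness_def)

  have "\<mu> dvd q - 1"
    using assms(3) by (rule cong_to_1_nat)
  then have dvd: "\<mu> div d dvd (q - 1) div d"
    using assms(1) by (metis div_dvd_div dvd_trans)
  have H: "subgroup ?H (mult_of F)" and K: "subgroup ?K (mult_of F)"
    by (rule F.subgroup_nonzero_powers)+
  let ?MK = "(mult_of F)\<lparr>carrier := ?K\<rparr>"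
  interpret MK: group ?MK
    by (rule M.subgroup_imp_group[OF K])
  have HK: "subgroup ?H ?MK"
    by (rule M.subgroup_incl[OF H K F.nonzero_powers_mono[OF dvd]])
  have KM: "?K \<subseteq> carrier (mult_of F)"
    using K by (rule subgroup.subset)
  then have finK: "finite ?K"
    using finM by (rule finite_subset)

  \<comment> \<open>For infinite \<open>S\<close>, \<open>mset_set S\<close> is empty by default,
    and an empty multiset cannot represent the coset \<open>?H\<close> itself.\<close>
  have finS: "finite S"
  proof (rule ccontr)
    assume "infinite S"
    then have "system_of_representatives ?MK ?H {#}"
      using assms(7) by simp
    moreover have "?H #>\<^bsub>?MK\<^esub> \<one>\<^bsub>?MK\<^esub> \<in> rcosets\<^bsub>?MK\<^esub> ?H"
      using HK by (intro MK.rcosetsI subgroup.subset MK.one_closed)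
    ultimately show False
      by (auto simp: system_of_representatives_def)
  qed
  then have SK: "S \<subseteq> ?K"
    using assms(7) by (simp add: system_of_representatives_def)
  with KM have SM: "S \<subseteq> carrier (mult_of F)"
    by blast

  have "mset_prod ?MK (mset_set ?H) (mset_set S) = mset_set (carrier ?MK)"
    using finK HK assms(7) by (intro MK.mset_prod_system_of_representatives) auto
  \<comment> \<open>Restricting the carrier to \<open>?K\<close> leaves the multiplication
    unchanged, so the product computed inside \<open>?K\<close> is also the product in the whole
    multiplicative group.\<close>
  then have HS: "mset_prod (mult_of F) (mset_set ?H) (mset_set S) = mset_set ?K"
    by (simp add: mset_prod_def)
  have KL: "(\<Sum>s\<in>S. image_mset (\<lambda>y. y \<otimes>\<^bsub>F\<^esub> s) (mset_prod (mult_of F) (mset_set ?H) (L g)))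
      = mset_set (carrier (mult_of F))" if g: "g \<in> carrier G" for g
  proof -
    have "set_mset (mset_set ?H) \<subseteq> carrier (mult_of F)"
      using subgroup.subset[OF H] finite_subset[OF _ finM] by auto
    then have "mset_prod (mult_of F) (mset_prod (mult_of F) (mset_set ?H) (L g)) (mset_set S)
        = mset_prod (mult_of F) (mset_set ?K) (L g)"
      using L[OF g] SM finS by (subst M.mset_prod_right_commute) (simp_all add: HS del: One_nat_def)
    also have "\<dots> = mset_set (carrier (mult_of F))"
      by (rule M.mset_prod_system_of_representatives[OF finM K assms(6)[OF g]])
    \<comment> \<open>Read by its second factor, the product with \<open>S\<close> is the union of
      the translates by \<open>s\<close>, the form in which scaling produces it.\<close>
    finally show ?thesis
      by (simp add: mset_prod_swap[of _ _ "mset_set S"] sum_unfold_sum_mset)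
  qed

  have "family_differences ?P (image_mset mset_set (scaled_family F S \<CC>))
      = (\<Sum>s\<in>S. family_differences ?P (image_mset mset_set (image_mset (scale F s) \<CC>)))"
    by (simp only: scaled_family_def image_mset_sum family_differences_sum)
  also have "\<dots> = (\<Sum>s\<in>S. image_mset (\<lambda>(x, y). (x, y \<otimes>\<^bsub>F\<^esub> s))
      (family_differences ?P (image_mset mset_set \<CC>)))"
    using SM by (intro sum.cong refl family_differences_scale[OF G F _ finP sub]) auto
  also have "\<dots> = (\<Sum>s\<in>S. \<Sum>g\<in>carrier G. image_mset (Pair g)
      (image_mset (\<lambda>y. y \<otimes>\<^bsub>F\<^esub> s) (mset_prod (mult_of F) (mset_set ?H) (L g))))"
    by (simp add: diff image_mset_sum multiset.map_comp comp_def)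
  \<comment> \<open>Collecting all scalings over a fixed \<open>g\<close> allows \<open>KL\<close>
    to be applied fibre by fibre.\<close>
  also have "\<dots> = (\<Sum>g\<in>carrier G. image_mset (Pair g)
      (\<Sum>s\<in>S. image_mset (\<lambda>y. y \<otimes>\<^bsub>F\<^esub> s) (mset_prod (mult_of F) (mset_set ?H) (L g))))"
    unfolding image_mset_sum by (rule sum.swap)
  also have "\<dots> = (\<Sum>g\<in>carrier G. image_mset (Pair g) (mset_set (carrier (mult_of F))))"
    using KL by (intro sum.cong) auto
  also have "\<dots> = mset_set (carrier G \<times> carrier (mult_of F))"
    using finG finM by (rule mset_set_Times[symmetric])
  also have "carrier G \<times> carrier (mult_of F) = carrier ?P - carrier G \<times> {\<zero>\<^bsub>F\<^esub>}"
    by auto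
  finally have main: "family_differences ?P (image_mset mset_set (scaled_family F S \<CC>))
      = mset_set (carrier ?P - carrier G \<times> {\<zero>\<^bsub>F\<^esub>})" .

  \<comment> \<open>Scaling by a nonzero \<open>s\<close> preserves cardinality, and the projection
    of \<open>C\<close>, taken with multiplicity, is a member of \<Sigma> and so has size
    \<open>k\<close>.\<close>
  have members: "B \<subseteq> carrier ?P \<and> card B = k" if mem: "B \<in># scaled_family F S \<CC>" for B
  proof -
    obtain s C where s: "s \<in> S" and C: "C \<in># \<CC>" and B: "B = scale F s C"
      using mem finS by (auto simp: scaled_family_def sum_unfold_sum_mset)
    have sM: "s \<in> carrier (mult_of F)"
      using s SM by blast
    have "B \<subseteq> carrier ?P"
      using sub[OF C] sM by (auto simp: B scale_def)
    moreover have "card B = card C"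
      unfolding B scale_def
      by (rule card_image[OF inj_on_subset[OF scale_inj_on[OF F sM] sub[OF C]]])
    moreover have "size (image_mset fst (mset_set C)) = k"
      using C by (intro size) (auto simp flip: proj)
    ultimately show ?thesis
      by simp
  qed

  have "group ?P"
    using G F.a_group by (rule DirProd_group)
  \<comment> \<open>This is the product of the full subgroup of \<open>G\<close> and the trivial
    additive subgroup of \<open>F\<close>.\<close>
  moreover have "subgroup (carrier G \<times> {\<zero>\<^bsub>F\<^esub>}) ?P"
    using DirProd_subgroups[OF G group.subgroup_self[OF G] F.a_group
        group.triv_subgroup[OF F.a_group]] by simp
  ultimately show ?thesis
    using finP members main by (simp add: relative_difference_family_def)
qed

end
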